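(* Let $\mathcal{K}$ be a class of compact groups and let $G=\prod_{i\in\mathbb{N}}H_i$ be an (unrestricted) direct product with $H_i\in\mathcal{K}$ for all $i$. Then every quotient of $G$ (by any normal subgroup, not necessarily topologically closed) is $\prod(\mathcal{K})$-approximable.
   Context: For a class $\mathcal{K}$ of groups, $\prod(\mathcal{K})$ is the class consisting of $\mathcal{K}$ and all finite direct products of groups from $\mathcal{K}$. For a group $H$, $X\subseteq H$ and $n\in\mathbb{N}$, put $C_n(X,H)=\{x_1^{g_1}\cdots x_n^{g_n} : x_i\in X\text{ or }x_i^{-1}\in X,\ g_i\in H\}$, where $x^g=g^{-1}xg$. A set $Y\subseteq H$ is $n$-separated from $X$ in $H$ if $Y\cap C_n(X,H)=\emptyset$. A group $G$ is $\mathcal{K}$-approximable if for every finite $\Phi\subset G$ and every $n\in\mathbb{N}$ there exist $H\in\mathcal{K}$ and a map $\phi:\Phi\to H$ (with no topological requirement) such that $\phi(1)=1$ (when $1\in\Phi$) and $\phi(\Phi\setminus\{1\})$ is $n$-separated in $H$ from $\{\phi(g)\phi(h)(\phi(gh))^{-1} : g,h,gh\in\Phi\}$. Compact groups are compact Hausdorff topological groups. *)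

theory Defs
  imports
    "HOL-Algebra.Coset"
    "HOL-Algebra.Product_Groups"
    "HOL-Analysis.T1_Spaces"
    "HOL-Analysis.Product_Topology"
begin

record 'a top_group = "'a monoid" +
  grp_topology :: "'a topology"

definition compact_group :: "'a top_group \<Rightarrow> bool"
  where "compact_group H \<longleftrightarrow>
    group H \<and>
    topspace (grp_topology H) = carrier H \<and>
    continuous_map (prod_topology (grp_topology H) (grp_topology H)) (grp_topology H)
      (\<lambda>(x, y). x \<otimes>\<^bsub>H\<^esub> y) \<and>
    continuous_map (grp_topology H) (grp_topology H) (\<lambda>x. inv\<^bsub>H\<^esub> x) \<and>
    compact_space (grp_topology H) \<and>
    Hausdorff_space (grp_topology H)"

(* The members of K and their finite direct products, as abstract groups. The class is taken
   up to isomorphism, so that both kinds of members can be represented over one type.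
   The product over the empty index set (the trivial group) is not adjoined. *)
definition finite_products ::
  "('a, 'm) monoid_scheme set \<Rightarrow> (nat \<Rightarrow> 'a) monoid set"
  where "finite_products K = {H. group H \<and>
    ((\<exists>L\<in>K. H \<cong> L) \<or>
     (\<exists>(I :: nat set) L. finite I \<and> I \<noteq> {} \<and> (\<forall>i\<in>I. L i \<in> K) \<and> H \<cong> product_group I L))}"

(* The products x_1^g_1 ... x_n^g_n, with factors indexed from 0. *)
definition conj_products :: "nat \<Rightarrow> 'a set \<Rightarrow> ('a, 'm) monoid_scheme \<Rightarrow> 'a set"
  where "conj_products n X H =
    {foldr (\<lambda>i z. (inv\<^bsub>H\<^esub> (g i) \<otimes>\<^bsub>H\<^esub> x i \<otimes>\<^bsub>H\<^esub> g i) \<otimes>\<^bsub>H\<^esub> z) [0..<n] \<one>\<^bsub>H\<^esub> | x g.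
      \<forall>i<n. x i \<in> carrier H \<and> (x i \<in> X \<or> inv\<^bsub>H\<^esub> (x i) \<in> X) \<and> g i \<in> carrier H}"

definition separated_from ::
  "nat \<Rightarrow> 'a set \<Rightarrow> 'a set \<Rightarrow> ('a, 'm) monoid_scheme \<Rightarrow> bool"
  where "separated_from n Y X H \<longleftrightarrow> Y \<inter> conj_products n X H = {}"

definition approximable ::
  "('h, 'm) monoid_scheme set \<Rightarrow> ('g, 'k) monoid_scheme \<Rightarrow> bool"
  where "approximable K G \<longleftrightarrow>
    (\<forall>\<Phi> n. finite \<Phi> \<and> \<Phi> \<subseteq> carrier G \<longrightarrow>
      (\<exists>H\<in>K. \<exists>\<phi>. \<phi> \<in> \<Phi> \<rightarrow> carrier H \<and>
        (\<one>\<^bsub>G\<^esub> \<in> \<Phi> \<longrightarrow> \<phi> \<one>\<^bsub>G\<^esub> = \<one>\<^bsub>H\<^esub>) \<and>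
        separated_from n (\<phi> ` (\<Phi> - {\<one>\<^bsub>G\<^esub>}))
          {\<phi> g \<otimes>\<^bsub>H\<^esub> \<phi> h \<otimes>\<^bsub>H\<^esub> inv\<^bsub>H\<^esub> (\<phi> (g \<otimes>\<^bsub>G\<^esub> h)) | g h.
            g \<in> \<Phi> \<and> h \<in> \<Phi> \<and> g \<otimes>\<^bsub>G\<^esub> h \<in> \<Phi>} H))"

end

(* Choose representatives in G of the elements of Phi. Their multiplicative errors form a finite
   subset X of N, and the products in conj_products n X G stay in N, so they miss the
   representatives y of nontrivial cosets. For a fixed choice of the factors x_1, ..., x_n the set
   of all products x_1^g_1 ... x_n^g_n is a product of subsets of the H_i, because the g_j range
   over all of G; hence y is already missed in one coordinate. Only finitely many pairs of y and
   (x_1, ..., x_n) occur, so projecting to finitely many coordinates preserves separation. *)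
theory Submission
  imports Defs
begin

text \<open>The fold from \<open>conj_products\<close>, but over an arbitrary index list instead of
  \<open>[0..<n]\<close>, so that its properties follow by induction on the list.\<close>

definition conj_word ::
  "('a, 'm) monoid_scheme \<Rightarrow> (nat \<Rightarrow> 'a) \<Rightarrow> (nat \<Rightarrow> 'a) \<Rightarrow> nat list \<Rightarrow> 'a"
  where "conj_word H x g js =
    foldr (\<lambda>i z. (inv\<^bsub>H\<^esub> (g i) \<otimes>\<^bsub>H\<^esub> x i \<otimes>\<^bsub>H\<^esub> g i) \<otimes>\<^bsub>H\<^esub> z) js \<one>\<^bsub>H\<^esub>"

lemma conj_word_simps [simp]:
  "conj_word H x g [] = \<one>\<^bsub>H\<^esub>"
  "conj_word H x g (j # js) =
    (inv\<^bsub>H\<^esub> (g j) \<otimes>\<^bsub>H\<^esub> x j \<otimes>\<^bsub>H\<^esub> g j) \<otimes>\<^bsub>H\<^esub> conj_word H x g js"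
  by (simp_all add: conj_word_def)

lemma mem_conj_products:
  "y \<in> conj_products n X H \<longleftrightarrow>
    (\<exists>x g. y = conj_word H x g [0..<n] \<and>
      (\<forall>i<n. x i \<in> carrier H \<and> (x i \<in> X \<or> inv\<^bsub>H\<^esub> (x i) \<in> X) \<and> g i \<in> carrier H))"
  unfolding conj_products_def conj_word_def by simp

lemma (in group) conj_word_closed:
  assumes "\<And>j. j \<in> set js \<Longrightarrow> x j \<in> carrier G \<and> g j \<in> carrier G"
  shows "conj_word G x g js \<in> carrier G"
  using assms by (induction js) auto

lemma conj_word_cong:
  assumes "\<And>j. j \<in> set js \<Longrightarrow> x j = x' j \<and> g j = g' j"
  shows "conj_word H x g js = conj_word H x' g' js"
  using assms by (induction js) auto

text \<open>A normal subgroup is closed under inverses, conjugation and multiplication. A factor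
  \<open>x i\<close> is allowed if only its inverse lies in \<open>X\<close>, and it is then
  recovered as the inverse of that element.\<close>

lemma (in normal) conj_products_subset:
  assumes "X \<subseteq> H"
  shows "conj_products n X G \<subseteq> H"
proof
  fix y assume "y \<in> conj_products n X G"
  then obtain x g where y: "y = conj_word G x g [0..<n]"
    and xg: "\<forall>i<n. x i \<in> carrier G \<and> (x i \<in> X \<or> inv (x i) \<in> X) \<and> g i \<in> carrier G"
    by (auto simp: mem_conj_products)
  have xH: "x j \<in> H" if "j < n" for j
    using xg that assms m_inv_closed inv_inv by (metis subsetD)
  have "conj_word G x g js \<in> H" if "set js \<subseteq> {..<n}" for js
    using that by (induction js) (use xg xH inv_op_closed1 in auto)
  then show "y \<in> H"
    using y by (simp add: subset_eq)
qed

lemma conj_word_product_group: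
  assumes "\<And>i. i \<in> I \<Longrightarrow> group (H i)" and "i \<in> I"
    and "\<And>j. j \<in> set js \<Longrightarrow>
      x j \<in> carrier (product_group I H) \<and> g j \<in> carrier (product_group I H)"
  shows "conj_word (product_group I H) x g js i = conj_word (H i) (\<lambda>j. x j i) (\<lambda>j. g j i) js"
  using assms(3) by (induction js) (use assms(1,2) in auto)

lemma restrict_in_hom_product_group:
  assumes "I \<subseteq> A"
  shows "(\<lambda>x. restrict x I) \<in> hom (product_group A H) (product_group I H)"
  using assms by (fastforce simp: hom_def PiE_iff intro!: restrict_ext)

text \<open>If every coordinate of \<open>y\<close> could be reached by conjugators of its own,
  these would assemble to conjugators in the whole product, the factors \<open>x\<close> staying the
  same. Then \<open>y\<close> itself would be a product of conjugates.\<close>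

lemma conj_products_avoids_coordinate:
  assumes gr: "\<And>i. i \<in> A \<Longrightarrow> group (H i)"
    and y: "y \<in> carrier (product_group A H)" "y \<notin> conj_products n X (product_group A H)"
    and x: "\<forall>j<n. x j \<in> carrier (product_group A H) \<and>
      (x j \<in> X \<or> inv\<^bsub>product_group A H\<^esub> (x j) \<in> X)"
  shows "\<exists>i\<in>A. \<forall>g. (\<forall>j<n. g j \<in> carrier (H i)) \<longrightarrow>
    y i \<noteq> conj_word (H i) (\<lambda>j. x j i) g [0..<n]"
proof (rule ccontr)
  let ?G = "product_group A H"
  assume "\<not> ?thesis"
  then have "\<forall>i\<in>A. \<exists>g. (\<forall>j<n. g j \<in> carrier (H i)) \<and>
      y i = conj_word (H i) (\<lambda>j. x j i) g [0..<n]"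
    by simp
  from bchoice[OF this] obtain g where g: "\<And>i j. i \<in> A \<Longrightarrow> j < n \<Longrightarrow> g i j \<in> carrier (H i)"
    and yg: "\<And>i. i \<in> A \<Longrightarrow> y i = conj_word (H i) (\<lambda>j. x j i) (g i) [0..<n]"
    by auto
  \<comment> \<open>The chosen conjugators with their arguments exchanged: \<open>g' j\<close> has
    \<open>g i j\<close> as its coordinate at \<open>i\<close>. No finite support is asked of it, so
    it belongs to the unrestricted product.\<close>
  define g' where "g' j = (\<lambda>i\<in>A. g i j)" for j
  have g': "g' j \<in> carrier ?G" if "j < n" for j
    using g that by (auto simp: g'_def)
  have "group ?G"
    using gr by simp
  have w: "conj_word ?G x g' [0..<n] \<in> carrier ?G"
    by (rule group.conj_word_closed[OF \<open>group ?G\<close>]) (use x g' in auto)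
  have "y = conj_word ?G x g' [0..<n]"
  proof (rule PiE_ext)
    show "y \<in> (\<Pi>\<^sub>E i\<in>A. carrier (H i))" "conj_word ?G x g' [0..<n] \<in> (\<Pi>\<^sub>E i\<in>A. carrier (H i))"
      using y(1) w by simp_all
    fix i assume i: "i \<in> A"
    have "conj_word ?G x g' [0..<n] i = conj_word (H i) (\<lambda>j. x j i) (\<lambda>j. g' j i) [0..<n]"
      by (rule conj_word_product_group) (use gr i x g' in auto)
    then show "y i = conj_word ?G x g' [0..<n] i"
      using i by (simp add: yg g'_def)
  qed
  then have "y \<in> conj_products n X ?G"
    unfolding mem_conj_products using x g' by (intro exI[of _ x] exI[of _ g'] conjI) simp_all
  with y(2) show False by contradiction
qed

text \<open>Each pair of an element of \<open>Y\<close> and a tuple of factors has a coordinate that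
  obstructs it. Finiteness of \<open>X\<close> and \<open>Y\<close> leaves finitely many pairs, and
  a projection that keeps all these coordinates keeps every obstruction.\<close>

lemma separated_from_finite_projection:
  assumes gr: "\<And>i. i \<in> A \<Longrightarrow> group (H i)" and "A \<noteq> {}"
    and X: "finite X" "X \<subseteq> carrier (product_group A H)"
    and Y: "finite Y" "Y \<subseteq> carrier (product_group A H)"
    and sep: "separated_from n Y X (product_group A H)"
  obtains I where "finite I" "I \<noteq> {}" "I \<subseteq> A"
    "separated_from n ((\<lambda>y. restrict y I) ` Y) ((\<lambda>x. restrict x I) ` X) (product_group I H)"
proof -
  let ?G = "product_group A H"
  interpret G: group ?G
    using gr by simp
  define S where "S = {x \<in> carrier ?G. x \<in> X \<or> inv\<^bsub>?G\<^esub> x \<in> X}"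
  have "S \<subseteq> X \<union> m_inv ?G ` X"
    unfolding S_def using G.inv_inv image_eqI by (smt (verit) UnCI mem_Collect_eq subsetI)
  then have "finite S"
    using X(1) finite_subset by blast
  \<comment> \<open>Tuples of factors are taken as extensional functions on \<open>{..<n}\<close>;
    arbitrary functions on the naturals would not form a finite set.\<close>
  define W where "W = ({..<n} \<rightarrow>\<^sub>E S)"
  have "finite W"
    unfolding W_def using \<open>finite S\<close> by (intro finite_PiE) auto
  have "\<exists>i\<in>A. \<forall>g. (\<forall>j<n. g j \<in> carrier (H i)) \<longrightarrow>
      y i \<noteq> conj_word (H i) (\<lambda>j. x j i) g [0..<n]" if "y \<in> Y" "x \<in> W" for y x
  proof (rule conj_products_avoids_coordinate)
    show "y \<notin> conj_products n X ?G"
      using sep that(1) by (auto simp: separated_from_def)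
  qed (use gr Y that in \<open>auto simp: W_def S_def PiE_iff\<close>)
  \<comment> \<open>\<open>f y x\<close> is a coordinate in which no conjugators turn the factors
    \<open>x\<close> into \<open>y\<close>.\<close>
  then obtain f where fA: "\<And>y x. y \<in> Y \<Longrightarrow> x \<in> W \<Longrightarrow> f y x \<in> A"
    and f: "\<And>y x g. y \<in> Y \<Longrightarrow> x \<in> W \<Longrightarrow> (\<forall>j<n. g j \<in> carrier (H (f y x))) \<Longrightarrow>
      y (f y x) \<noteq> conj_word (H (f y x)) (\<lambda>j. x j (f y x)) g [0..<n]"
    by metis
  obtain a where "a \<in> A"
    using \<open>A \<noteq> {}\<close> by blast
  \<comment> \<open>The extra index \<open>a\<close> keeps \<open>I\<close> nonempty even if there
    are no pairs, since \<open>finite_products\<close> does not admit the product over the empty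
    set.\<close>
  define I where "I = insert a ((\<lambda>(y, x). f y x) ` (Y \<times> W))"
  have I: "finite I" "I \<noteq> {}" "I \<subseteq> A"
    unfolding I_def using \<open>a \<in> A\<close> fA Y(1) \<open>finite W\<close> by auto
  let ?P = "product_group I H"
  interpret P: group ?P
    by (rule product_group) (use gr I(3) in blast)
  interpret r: group_hom ?G ?P "\<lambda>x. restrict x I"
    using restrict_in_hom_product_group[OF I(3)] by unfold_locales
  have "restrict y I \<notin> conj_products n ((\<lambda>x. restrict x I) ` X) ?P" if "y \<in> Y" for y
  proof
    assume "restrict y I \<in> conj_products n ((\<lambda>x. restrict x I) ` X) ?P"
    then obtain x g where yx: "restrict y I = conj_word ?P x g [0..<n]"
      and x: "\<And>j. j < n \<Longrightarrow> x j \<in> carrier ?P"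
        "\<And>j. j < n \<Longrightarrow> x j \<in> (\<lambda>x. restrict x I) ` X \<or> inv\<^bsub>?P\<^esub> (x j) \<in> (\<lambda>x. restrict x I) ` X"
      and g: "\<And>j. j < n \<Longrightarrow> g j \<in> carrier ?P"
      unfolding mem_conj_products by blast
    \<comment> \<open>Each factor in the projection lifts to a factor in the full product. If only
      the inverse of \<open>x j\<close> comes from some \<open>z\<close> in \<open>X\<close>, the
      inverse of \<open>z\<close> is a lift, because restriction is a homomorphism.\<close>
    have "\<exists>w\<in>S. restrict w I = x j" if "j < n" for j
      using x(2)[OF that]
    proof
      assume "x j \<in> (\<lambda>x. restrict x I) ` X"
      then obtain z where "z \<in> X" "x j = restrict z I"
        by blast
      moreover have "z \<in> S"
        using \<open>z \<in> X\<close> X(2) unfolding S_def by blast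
      ultimately show ?thesis by metis
    next
      assume "inv\<^bsub>?P\<^esub> (x j) \<in> (\<lambda>x. restrict x I) ` X"
      then obtain z where z: "z \<in> X" "inv\<^bsub>?P\<^esub> (x j) = restrict z I"
        by blast
      then have zG: "z \<in> carrier ?G"
        using X(2) by blast
      have "restrict (inv\<^bsub>?G\<^esub> z) I = x j"
        using r.hom_inv[OF zG] z(2) P.inv_inv[OF x(1)[OF that]] by metis
      moreover have "inv\<^bsub>?G\<^esub> z \<in> S"
        using zG z(1) unfolding S_def by (metis (mono_tags) G.inv_closed G.inv_inv mem_Collect_eq)
      ultimately show ?thesis by blast
    qed
    then obtain w where w: "\<And>j. j < n \<Longrightarrow> w j \<in> S \<and> restrict (w j) I = x j"
      by metis
    \<comment> \<open>Cutting \<open>w\<close> down to the indices below \<open>n\<close> makes it a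
      member of \<open>W\<close>; the word only reads these indices.\<close>
    define v where "v = restrict w {..<n}"
    have vW: "v \<in> W"
      unfolding v_def W_def using w by auto
    \<comment> \<open>The coordinate obstructing \<open>y\<close> for the lifted tuple. It was put
      into \<open>I\<close>, so the word in the projection can still be read there.\<close>
    define i where "i = f y v"
    have i: "i \<in> I"
      unfolding i_def I_def using \<open>y \<in> Y\<close> vW by auto
    have "y i = conj_word ?P x g [0..<n] i"
      using yx i by (metis restrict_apply')
    also have "\<dots> = conj_word (H i) (\<lambda>j. x j i) (\<lambda>j. g j i) [0..<n]"
      by (rule conj_word_product_group) (use gr I(3) i x g in auto)
    also have "\<dots> = conj_word (H i) (\<lambda>j. v j i) (\<lambda>j. g j i) [0..<n]"
    proof (rule conj_word_cong)
      fix j assume "j \<in> set [0..<n]"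
      then have "j < n" by simp
      then show "x j i = v j i \<and> g j i = g j i"
        using w[of j] i unfolding v_def by (metis lessThan_iff restrict_apply')
    qed
    finally show False
      using f[OF \<open>y \<in> Y\<close> vW, of "\<lambda>j. g j i"] g i by (auto simp: i_def PiE_iff)
  qed
  then have "separated_from n ((\<lambda>y. restrict y I) ` Y) ((\<lambda>x. restrict x I) ` X) ?P"
    by (auto simp: separated_from_def)
  with I show thesis by (rule that)
qed

lemma image_Collect2: "f ` {e g h | g h. P g h} = {f (e g h) | g h. P g h}"
  unfolding image_def by auto

theorem mainTheorem11:
  fixes K :: "'a top_group set"
    and H :: "nat \<Rightarrow> 'a top_group"
    and N :: "(nat \<Rightarrow> 'a) set"
  assumes "\<forall>L\<in>K. compact_group L"
    and "\<forall>i. H i \<in> K"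
    and "N \<lhd> product_group UNIV H"
  shows "approximable (finite_products K) (product_group UNIV H Mod N)"
  unfolding approximable_def
proof (intro allI impI, elim conjE)
  let ?G = "product_group UNIV H"
  let ?Q = "?G Mod N"
  fix \<Phi> n assume \<Phi>: "finite \<Phi>" "\<Phi> \<subseteq> carrier ?Q"
  have gr: "group (H i)" for i
    using assms(1,2) by (auto simp: compact_group_def)
  interpret N: normal N ?G
    by fact
  interpret \<pi>: group_hom ?G ?Q "\<lambda>a. N #>\<^bsub>?G\<^esub> a"
    using N.r_coset_hom_Mod N.factorgroup_is_group
    by (simp add: group_hom_def group_hom_axioms_def N.is_group)
  have \<pi>N: "a \<in> N \<longleftrightarrow> N #>\<^bsub>?G\<^esub> a = \<one>\<^bsub>?Q\<^esub>" if "a \<in> carrier ?G" for a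
    using N.coset_join1[OF _ that N.is_subgroup] N.coset_join2[OF that N.is_subgroup]
    by (auto simp: FactGroup_def)
  \<comment> \<open>The trivial coset is represented by the identity itself; this later gives
    \<open>\<phi>\<close> the value one at the identity.\<close>
  have "\<exists>a\<in>carrier ?G. N #>\<^bsub>?G\<^esub> a = q \<and> (q = \<one>\<^bsub>?Q\<^esub> \<longrightarrow> a = \<one>\<^bsub>?G\<^esub>)" if "q \<in> carrier ?Q" for q
  proof (cases "q = \<one>\<^bsub>?Q\<^esub>")
    case True
    then show ?thesis
      using \<pi>.hom_one by blast
  next
    case False
    then show ?thesis
      using that by (auto simp: FactGroup_def RCOSETS_def)
  qed
  then obtain s where sG: "\<And>q. q \<in> carrier ?Q \<Longrightarrow> s q \<in> carrier ?G"
    and \<pi>s: "\<And>q. q \<in> carrier ?Q \<Longrightarrow> N #>\<^bsub>?G\<^esub> s q = q"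
    and s1: "s \<one>\<^bsub>?Q\<^esub> = \<one>\<^bsub>?G\<^esub>"
    by (metis (no_types, lifting) \<pi>.H.one_closed)
  define err where "err g h = s g \<otimes>\<^bsub>?G\<^esub> s h \<otimes>\<^bsub>?G\<^esub> inv\<^bsub>?G\<^esub> s (g \<otimes>\<^bsub>?Q\<^esub> h)" for g h
  define X where "X = {err g h | g h. g \<in> \<Phi> \<and> h \<in> \<Phi> \<and> g \<otimes>\<^bsub>?Q\<^esub> h \<in> \<Phi>}"
  have "X \<subseteq> (\<lambda>(g, h). err g h) ` (\<Phi> \<times> \<Phi>)"
    by (auto simp: X_def)
  then have "finite X"
    using \<Phi>(1) finite_subset by blast
  \<comment> \<open>The quotient map sends \<open>err g h\<close> to the product of
    \<open>g\<close>, \<open>h\<close> and the inverse of their product, which is trivial.\<close>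
  have XN: "X \<subseteq> N"
  proof
    fix x assume "x \<in> X"
    then obtain g h where gh: "g \<in> carrier ?Q" "h \<in> carrier ?Q" and x: "x = err g h"
      using \<Phi>(2) unfolding X_def by blast
    have sgh: "s g \<in> carrier ?G" "s h \<in> carrier ?G" "s (g \<otimes>\<^bsub>?Q\<^esub> h) \<in> carrier ?G"
      using gh sG \<pi>.H.m_closed by blast+
    have "N #>\<^bsub>?G\<^esub> err g h = g \<otimes>\<^bsub>?Q\<^esub> h \<otimes>\<^bsub>?Q\<^esub> inv\<^bsub>?Q\<^esub> (g \<otimes>\<^bsub>?Q\<^esub> h)"
      unfolding err_def using sgh gh
      by (simp only: \<pi>.hom_mult \<pi>.hom_inv N.m_closed N.inv_closed \<pi>s \<pi>.H.m_closed)
    also have "\<dots> = \<one>\<^bsub>?Q\<^esub>"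
      using gh \<pi>.H.m_closed \<pi>.H.r_inv by blast
    finally show "x \<in> N"
      using \<pi>N[of "err g h"] sgh x unfolding err_def by blast
  qed
  define Y where "Y = s ` (\<Phi> - {\<one>\<^bsub>?Q\<^esub>})"
  have YG: "Y \<subseteq> carrier ?G"
    using sG \<Phi>(2) unfolding Y_def by blast
  \<comment> \<open>A representative in \<open>N\<close> would represent the trivial coset. Since
    all products of conjugates from \<open>X\<close> stay in \<open>N\<close>, the set
    \<open>Y\<close> is separated from \<open>X\<close>.\<close>
  have "s q \<notin> N" if "q \<in> \<Phi>" "q \<noteq> \<one>\<^bsub>?Q\<^esub>" for q
    using that \<Phi>(2) \<pi>N[OF sG] \<pi>s by blast
  then have "Y \<inter> N = {}"
    unfolding Y_def by blast
  then have sep: "separated_from n Y X ?G"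
    using N.conj_products_subset[OF XN] unfolding separated_from_def by blast
  obtain I where I: "finite I" "I \<noteq> {}" and
    sepI: "separated_from n ((\<lambda>y. restrict y I) ` Y) ((\<lambda>x. restrict x I) ` X) (product_group I H)"
    by (rule separated_from_finite_projection[OF _ _ \<open>finite X\<close> _ _ YG sep])
      (use gr XN N.subset \<Phi>(1) in \<open>auto simp: Y_def\<close>)
  let ?P = "product_group I H"
  interpret P: group ?P
    using gr by simp
  interpret r: group_hom ?G ?P "\<lambda>x. restrict x I"
    using restrict_in_hom_product_group[OF subset_UNIV] by unfold_locales
  define \<phi> where "\<phi> q = restrict (s q) I" for q
  \<comment> \<open>Restriction to \<open>I\<close> is a homomorphism, so the errors of
    \<open>\<phi>\<close> are the restrictions of the errors of \<open>s\<close>.\<close>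
  have \<phi>_err: "\<phi> g \<otimes>\<^bsub>?P\<^esub> \<phi> h \<otimes>\<^bsub>?P\<^esub> inv\<^bsub>?P\<^esub> \<phi> (g \<otimes>\<^bsub>?Q\<^esub> h) = restrict (err g h) I"
    if "g \<in> \<Phi>" "h \<in> \<Phi>" for g h
  proof -
    have "g \<in> carrier ?Q" "h \<in> carrier ?Q"
      using that \<Phi>(2) by blast+
    then have "s g \<in> carrier ?G" "s h \<in> carrier ?G" "s (g \<otimes>\<^bsub>?Q\<^esub> h) \<in> carrier ?G"
      using sG \<pi>.H.m_closed by blast+
    then show ?thesis
      unfolding \<phi>_def err_def by (simp only: r.hom_mult r.hom_inv N.m_closed N.inv_closed)
  qed
  have "?P \<in> finite_products K"
    unfolding finite_products_def using P.is_group I assms(2) iso_refl[of ?P] by blast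
  have "\<phi> \<in> \<Phi> \<rightarrow> carrier ?P"
    using sG \<Phi>(2) r.hom_closed unfolding \<phi>_def by blast
  have "\<phi> \<one>\<^bsub>?Q\<^esub> = \<one>\<^bsub>?P\<^esub>"
    unfolding \<phi>_def s1 by (rule r.hom_one)
  have "{\<phi> g \<otimes>\<^bsub>?P\<^esub> \<phi> h \<otimes>\<^bsub>?P\<^esub> inv\<^bsub>?P\<^esub> \<phi> (g \<otimes>\<^bsub>?Q\<^esub> h) | g h.
      g \<in> \<Phi> \<and> h \<in> \<Phi> \<and> g \<otimes>\<^bsub>?Q\<^esub> h \<in> \<Phi>} = (\<lambda>x. restrict x I) ` X"
    \<comment> \<open>\<open>\<phi>_err\<close> holds only for \<open>g\<close> and \<open>h\<close>
      in \<open>\<Phi>\<close>; \<open>rev_conj_cong\<close> makes the membership conditions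
      available while the equation to their left is rewritten.\<close>
    unfolding X_def image_Collect2
    by (rule Collect_cong, (rule ex_cong1)+, rule rev_conj_cong)
      (simp_all only: \<phi>_err)
  moreover have "\<phi> ` (\<Phi> - {\<one>\<^bsub>?Q\<^esub>}) = (\<lambda>y. restrict y I) ` Y"
    unfolding Y_def \<phi>_def by blast
  ultimately have "separated_from n (\<phi> ` (\<Phi> - {\<one>\<^bsub>?Q\<^esub>}))
      {\<phi> g \<otimes>\<^bsub>?P\<^esub> \<phi> h \<otimes>\<^bsub>?P\<^esub> inv\<^bsub>?P\<^esub> \<phi> (g \<otimes>\<^bsub>?Q\<^esub> h) | g h.
        g \<in> \<Phi> \<and> h \<in> \<Phi> \<and> g \<otimes>\<^bsub>?Q\<^esub> h \<in> \<Phi>} ?P"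
    using sepI by (simp only:)
  then show "\<exists>P\<in>finite_products K. \<exists>\<phi>. \<phi> \<in> \<Phi> \<rightarrow> carrier P \<and>
      (\<one>\<^bsub>?Q\<^esub> \<in> \<Phi> \<longrightarrow> \<phi> \<one>\<^bsub>?Q\<^esub> = \<one>\<^bsub>P\<^esub>) \<and>
      separated_from n (\<phi> ` (\<Phi> - {\<one>\<^bsub>?Q\<^esub>}))
        {\<phi> g \<otimes>\<^bsub>P\<^esub> \<phi> h \<otimes>\<^bsub>P\<^esub> inv\<^bsub>P\<^esub> \<phi> (g \<otimes>\<^bsub>?Q\<^esub> h) | g h.
          g \<in> \<Phi> \<and> h \<in> \<Phi> \<and> g \<otimes>\<^bsub>?Q\<^esub> h \<in> \<Phi>} P"
    using \<open>?P \<in> finite_products K\<close> \<open>\<phi> \<in> \<Phi> \<rightarrow> carrier ?P\<close> \<open>\<phi> \<one>\<^bsub>?Q\<^esub> = \<one>\<^bsub>?P\<^esub>\<close>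
    by (intro bexI[of _ ?P] exI[of _ \<phi>] conjI impI)
qed

end
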